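(* Suppose that the preconditioned dual proximal gradient iteration (with step parameter $t>0$) $$p^{k+1}=\operatorname*{arg\,min}_{p\in\mathbb{R}^{\mathcal E},\ \|p\|_\infty\le 1}\ -\langle K\nabla G^*(-K^\top p^k),p\rangle+\frac t2\|p-p^k\|_{T_k}^2$$ generates a sequence $\{p^k\}$ which converges to a minimizer $p^*\in\mathbb{R}^{\mathcal E}$ of $$\min_{p\in\mathbb{R}^{\mathcal E},\ \|p\|_\infty\le 1} G^*(-K^\top p).$$ Assume that: (A1) for each $e\in\mathcal E$, $\left(K\nabla G^*(-K^\top p^* )\right)_e=0$ implies $|p^*_e|<1$; (A2) for each $k\in\mathbb{N}$, $\underline t I\preceq T_k\preceq\bar t I$ with fixed $\underline t,\bar t>0$; (A3) $T_k$ depends on $p^k$ only through $\mathcal A(p^k)$. Then there exists $\bar k\in\mathbb{N}$ such that for all $k\ge\bar k$: (i) (Finite identification) $\mathcal A(p^k)=\mathcal A(p^* )\equiv\mathcal A^*$ and $T_k\equiv T$ (a constant matrix). (ii) (Local linear convergence) $$\|p^k-p^*\|_T\le\left(\frac{\varphi-1}{\varphi+1}\right)^{k-\bar k}\|p^{\bar k}-p^*\|_T,\qquad \varphi=\kappa\left(\Pi_{U(\mathcal A^* )}T^{-1/2}K\right)^2\cdot\kappa(G^* ),$$ where $\Pi_{U(\mathcal A^* )}$ is the orthogonal projection onto the subspace $U(\mathcal A^* ):=\ker(P_{\mathcal A^*}T^{-1/2})$.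
   Context: Let $\mathcal G=(\mathcal V,\mathcal E,\omega)$ be an undirected weighted graph with edge weights $\omega:\mathcal E\to\mathbb{R}_{>0}$. Fix an arbitrary orientation of the edges and let $\nabla:\mathbb{R}^{\mathcal V}\to\mathbb{R}^{\mathcal E}$ be the transposed incidence matrix, $(\nabla u)_e=u_i-u_j$ for $e=(i,j)\in\mathcal E$. Set $K=\operatorname{diag}(\omega)\nabla$. $G:\mathbb{R}^{\mathcal V}\to\mathbb{R}\cup\{+\infty\}$ is proper, lower semicontinuous and convex, with Fenchel conjugate $G^*$. It is assumed that $G^*$ is $C^2$ with $l_{G^*}I\preceq\nabla^2G^*(\cdot)\preceq L_{G^*}I$ for constants $l_{G^*},L_{G^*}>0$; put $\kappa(G^* ):=L_{G^*}/l_{G^*}$. (In the expression $\nabla G^*$ the symbol $\nabla$ denotes the gradient of $G^*$.) Each $T_k\in\mathbb{R}^{|\mathcal E|\times|\mathcal E|}$ is symmetric positive definite, and for a symmetric positive definite matrix $T$, $\|p\|_T^2:=p^\top Tp$. For $p\in\mathbb{R}^{\mathcal E}$ with $\|p\|_\infty\le1$, the active set is $\mathcal A(p)=\{e\in\mathcal E: |p_e|=1\}$. For $\mathcal A\subseteq\mathcal E$, $P_{\mathcal A}$ is the projection matrix on $\mathbb{R}^{\mathcal E}$ given by $(P_{\mathcal A}p)_e=p_e$ if $e\in\mathcal A$ and $(P_{\mathcal A}p)_e=0$ otherwise. For a matrix $M$, $\sigma_{\max}(M)$ is its largest and $\sigma_{\min>0}(M)$ its smallest positive singular value, and $\kappa(M)=\sigma_{\max}(M)/\sigma_{\min>0}(M)$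 is its (finite) condition number.
   Formalization: Part (ii) is claimed only for t = (l_{G*} σ_{min>0}(B)² + L_{G*} σ_max(B)²)/2 with B = Π_{U(A* )} T^{-1/2} K (any t>0 if B = 0), because for other t the stated rate can fail; part (i) holds for every t>0. *)

theory Defs
  imports "HOL-Analysis.Analysis"
begin

subsection \<open>Graphs\<close>

text \<open>
  The vertices and edges of a finite simple graph are the elements of two finite types;
  \<open>src\<close> and \<open>tgt\<close> give the ends of an edge in the chosen orientation. Injectivity rules out
  parallel as well as antiparallel edges.
\<close>

definition oriented_simple_graph :: "('e \<Rightarrow> 'v) \<Rightarrow> ('e \<Rightarrow> 'v) \<Rightarrow> bool" where
  "oriented_simple_graph src tgt \<longleftrightarrow>
     (\<forall>e. src e \<noteq> tgt e) \<and> inj (\<lambda>e. {src e, tgt e})"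

definition graph_gradient :: "('e \<Rightarrow> 'v) \<Rightarrow> ('e \<Rightarrow> 'v) \<Rightarrow> real ^ 'v::finite ^ 'e::finite" where
  "graph_gradient src tgt =
     (\<chi> e v. (if v = src e then 1 else 0) - (if v = tgt e then 1 else 0))"

lemma graph_gradient_apply: "(graph_gradient src tgt *v u) $ e = u $ src e - u $ tgt e"
  by (simp add: graph_gradient_def matrix_vector_mult_def left_diff_distrib sum_subtractf
      if_distrib[where f="\<lambda>x. x * _"] cong: if_cong)

definition diag_matrix :: "('n \<Rightarrow> real) \<Rightarrow> real ^ 'n::finite ^ 'n" where
  "diag_matrix d = (\<chi> i j. if i = j then d i else 0)"


subsection \<open>Extended-real-valued convex functions and conjugates\<close>

definition proper_fun :: "('a \<Rightarrow> ereal) \<Rightarrow> bool" where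
  "proper_fun G \<longleftrightarrow> (\<forall>x. G x \<noteq> -\<infinity>) \<and> (\<exists>x. G x \<noteq> \<infinity>)"

definition lower_semicont :: "('a::topological_space \<Rightarrow> ereal) \<Rightarrow> bool" where
  "lower_semicont G \<longleftrightarrow> (\<forall>x. G x \<le> Liminf (at x) G)"

definition convex_fun :: "('a::real_vector \<Rightarrow> ereal) \<Rightarrow> bool" where
  "convex_fun G \<longleftrightarrow>
     (\<forall>x y u. 0 < u \<and> u < 1 \<longrightarrow>
        G ((1 - u) *\<^sub>R x + u *\<^sub>R y) \<le> ereal (1 - u) * G x + ereal u * G y)"

definition fenchel_conj :: "('a::real_inner \<Rightarrow> ereal) \<Rightarrow> 'a \<Rightarrow> ereal" where
  "fenchel_conj G y = (SUP x. ereal (x \<bullet> y) - G x)"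


subsection \<open>Gradient and Hessian\<close>

definition grad :: "(real ^ 'n::finite \<Rightarrow> real) \<Rightarrow> real ^ 'n \<Rightarrow> real ^ 'n" where
  "grad f x = (THE D. GDERIV f x :> D)"

definition hessian :: "(real ^ 'n::finite \<Rightarrow> real) \<Rightarrow> real ^ 'n \<Rightarrow> real ^ 'n ^ 'n" where
  "hessian f x = matrix (frechet_derivative (grad f) (at x))"

definition twice_cont_diff :: "(real ^ 'n::finite \<Rightarrow> real) \<Rightarrow> bool" where
  "twice_cont_diff f \<longleftrightarrow>
     (\<forall>x. f differentiable (at x)) \<and> (\<forall>x. grad f differentiable (at x)) \<and>
     continuous_on UNIV (hessian f)"


subsection \<open>Symmetric matrices\<close>

definition pos_semidef :: "real ^ 'n::finite ^ 'n \<Rightarrow> bool" where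
  "pos_semidef A \<longleftrightarrow> transpose A = A \<and> (\<forall>x. 0 \<le> x \<bullet> (A *v x))"

definition pos_def :: "real ^ 'n::finite ^ 'n \<Rightarrow> bool" where
  "pos_def A \<longleftrightarrow> transpose A = A \<and> (\<forall>x. x \<noteq> 0 \<longrightarrow> 0 < x \<bullet> (A *v x))"

definition loewner_le :: "real ^ 'n::finite ^ 'n \<Rightarrow> real ^ 'n ^ 'n \<Rightarrow> bool"
    (infix \<open>\<preceq>\<^sub>L\<close> 50) where
  "A \<preceq>\<^sub>L B \<longleftrightarrow> pos_semidef (B - A)"

definition norm_wrt :: "real ^ 'n::finite ^ 'n \<Rightarrow> real ^ 'n \<Rightarrow> real" where
  "norm_wrt T p = sqrt (p \<bullet> (T *v p))"

text \<open>The unique symmetric positive definite square root; meaningful for positive definite \<open>A\<close>.\<close>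

definition matrix_sqrt :: "real ^ 'n::finite ^ 'n \<Rightarrow> real ^ 'n ^ 'n" where
  "matrix_sqrt A = (THE S. pos_def S \<and> S ** S = A)"

definition matrix_inv_sqrt :: "real ^ 'n::finite ^ 'n \<Rightarrow> real ^ 'n ^ 'n" where
  "matrix_inv_sqrt A = matrix_inv (matrix_sqrt A)"


subsection \<open>Singular values\<close>

text \<open>
  The square roots of the eigenvalues of \<open>M\<^sup>T M\<close>. This may contain additional zeros compared with
  the eigenvalues of \<open>M M\<^sup>T\<close>, which affects neither \<open>sigma_max\<close> nor \<open>sigma_min_pos\<close>.
\<close>

definition singular_values :: "real ^ 'n::finite ^ 'm::finite \<Rightarrow> real set" where
  "singular_values M =
     {s. 0 \<le> s \<and> (\<exists>v. v \<noteq> 0 \<and> (transpose M ** M) *v v = s\<^sup>2 *\<^sub>R v)}"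

definition sigma_max :: "real ^ 'n::finite ^ 'm::finite \<Rightarrow> real" where
  "sigma_max M = Max (singular_values M)"

text \<open>For \<open>M = 0\<close> there is no positive singular value and the next two notions are unspecified.\<close>

definition sigma_min_pos :: "real ^ 'n::finite ^ 'm::finite \<Rightarrow> real" where
  "sigma_min_pos M = Min {s \<in> singular_values M. 0 < s}"

definition cond_number :: "real ^ 'n::finite ^ 'm::finite \<Rightarrow> real" where
  "cond_number M = sigma_max M / sigma_min_pos M"


subsection \<open>Active sets and projections\<close>

definition active_set :: "real ^ 'e::finite \<Rightarrow> 'e set" where
  "active_set p = {e. \<bar>p $ e\<bar> = 1}"

definition coord_proj :: "'e set \<Rightarrow> real ^ 'e::finite ^ 'e" where
  "coord_proj A = diag_matrix (\<lambda>e. if e \<in> A then 1 else 0)"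

definition orth_proj :: "(real ^ 'n::finite) set \<Rightarrow> real ^ 'n ^ 'n" where
  "orth_proj U = (THE P. \<forall>x. P *v x \<in> U \<and> (\<forall>y\<in>U. (x - P *v x) \<bullet> y = 0))"

definition inactive_space :: "real ^ 'e::finite ^ 'e \<Rightarrow> 'e set \<Rightarrow> (real ^ 'e) set" where
  "inactive_space T A = {x. (coord_proj A ** matrix_inv_sqrt T) *v x = 0}"

definition projected_operator ::
  "real ^ 'e::finite ^ 'e \<Rightarrow> 'e set \<Rightarrow> real ^ 'v::finite ^ 'e \<Rightarrow> real ^ 'v ^ 'e" where
  "projected_operator T A K = orth_proj (inactive_space T A) ** matrix_inv_sqrt T ** K"


subsection \<open>Step parameter\<close>

text \<open>
  On the face selected by an active set the iteration is gradient descent with step \<open>1 / t\<close> on a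
  function whose curvature, along the range of its Hessian, lies between \<open>l * (sigma_min_pos B)\<^sup>2\<close>
  and \<open>L * (sigma_max B)\<^sup>2\<close>. The contraction factor
  \<open>(\<phi> - 1) / (\<phi> + 1)\<close> with \<open>\<phi> = (cond_number B)\<^sup>2 * (L / l)\<close> belongs to the classical step
  below; for other values of \<open>t\<close> it cannot be guaranteed. If \<open>B = 0\<close> the
  iteration is eventually stationary and \<open>t\<close> is immaterial.
\<close>

definition classical_step ::
  "real \<Rightarrow> real \<Rightarrow> real ^ 'v::finite ^ 'e::finite \<Rightarrow> real \<Rightarrow> bool" where
  "classical_step l L B t \<longleftrightarrow>
     (B \<noteq> 0 \<longrightarrow> t = (l * (sigma_min_pos B)\<^sup>2 + L * (sigma_max B)\<^sup>2) / 2)"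

end

theory Submission
  imports Defs
begin

text \<open>
  Write \<open>g q = K \<nabla>G\<^sup>*(-K\<^sup>T q)\<close> for the negative gradient of the dual objective.

  \<^emph>\<open>Identification.\<close> The minimality of \<open>p (Suc k)\<close> on the box says that each coordinate of the
  residual \<open>g (p k) - t T\<^sub>k (p (Suc k) - p k)\<close> can be positive only where \<open>p (Suc k)\<close> is \<open>1\<close> and
  negative only where it is \<open>-1\<close> (\<open>box_prox_optimality\<close>). As the iterates converge and the metrics are
  bounded, the residual tends to \<open>g pstar\<close>. Coordinates with a nonzero limit are therefore eventually
  clamped, and strict complementarity keeps all the others away from the boundary
  (\<open>finite_identification\<close>). From then on the active set, and with it the metric \<open>T\<close>, is constant.

  \<^emph>\<open>Reduction to gradient descent.\<close> Put \<open>z k = T\<^sup>1\<^sup>/\<^sup>2 (p k - pstar)\<close>, whose Euclidean norm is the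
  \<open>T\<close>-norm of the error, and \<open>B = \<Pi>\<^sub>U T\<^sup>-\<^sup>1\<^sup>/\<^sup>2 K\<close>. After identification \<open>z k\<close> lies in \<open>U\<close>, where
  \<open>B\<^sup>T z = K\<^sup>T T\<^sup>-\<^sup>1\<^sup>/\<^sup>2 z\<close>, and the vanishing of the residual in the inactive coordinates becomes
  \<open>z (Suc k) = z k + (1/t) B (\<nabla>G\<^sup>*(c - B\<^sup>T z k) - \<nabla>G\<^sup>* c)\<close> with \<open>c = -K\<^sup>T pstar\<close>
  (\<open>rescaled_step_eq_projected_operator\<close>).

  \<^emph>\<open>Contraction.\<close> The increments of \<open>z\<close> lie in the range of \<open>B\<close>, so the component of \<open>z k\<close> orthogonal
  to this range never changes; as it tends to \<open>0\<close>, it is \<open>0\<close>. This confines the error to the subspace on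
  which the derivative \<open>B H B\<^sup>T\<close>, with \<open>H\<close> a Hessian of \<open>G\<^sup>*\<close>, has its spectrum between
  \<open>a = l \<sigma>\<^sub>m\<^sub>i\<^sub>n\<^sup>2 > 0\<close> and \<open>b = L \<sigma>\<^sub>m\<^sub>a\<^sub>x\<^sup>2\<close>. With \<open>t = (a + b) / 2\<close> the map \<open>I - B H B\<^sup>T / t\<close> has norm at most
  \<open>(b - a) / (b + a)\<close> there, which is \<open>(\<phi> - 1) / (\<phi> + 1)\<close> because \<open>\<phi> = b / a\<close>
  (\<open>gradient_step_contraction\<close>). If \<open>B = 0\<close>, the range is trivial and \<open>z k = 0\<close>.

  Square roots, projections and singular values are specified by unique or extremal existence, so they
  become usable only through existence results; the spectral ones all rest on
  \<open>rayleigh_minimizer_is_eigenvector\<close>.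
\<close>

section \<open>Self-adjoint maps on invariant subspaces\<close>

text \<open>
  The form in which first-order optimality conditions are read off from a quadratic expansion along a
  segment.
\<close>

lemma nonpos_if_first_order_le_second_order:
  fixes a c :: real
  assumes "\<And>s. 0 < s \<Longrightarrow> s \<le> 1 \<Longrightarrow> s * a \<le> s\<^sup>2 * c"
  shows "a \<le> 0"
proof (rule ccontr)
  assume "\<not> a \<le> 0"
  then have a: "a > 0" by simp
  define s where "s = min 1 (a / (2 * (\<bar>c\<bar> + 1)))"
  have s: "0 < s" "s \<le> 1" "s \<le> a / (2 * (\<bar>c\<bar> + 1))"
    using a by (auto simp: s_def intro!: divide_pos_pos add_nonneg_pos)
  have "a \<le> s * c"
    using assms[OF s(1,2)] s(1) by (simp add: power2_eq_square)
  also have "\<dots> \<le> s * (\<bar>c\<bar> + 1)"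
    using s(1) by (intro mult_left_mono) auto
  also have "\<dots> \<le> a / 2"
    using s(3) by (subst (asm) pos_le_divide_eq) (auto simp: algebra_simps)
  finally show False using a by simp
qed

text \<open>
  On the unit sphere of \<open>R\<close> the quadratic form attains its minimum by compactness, and
  stationarity at the minimizer within \<open>R\<close> is the eigenvalue equation because \<open>R\<close> is invariant.
\<close>

lemma rayleigh_minimizer_is_eigenvector:
  fixes f :: "'a::euclidean_space \<Rightarrow> 'a"
  assumes lin: "linear f" and sym: "\<And>x y. f x \<bullet> y = x \<bullet> f y"
    and R: "subspace R" "f ` R \<subseteq> R" "R \<noteq> {0}"
  obtains z where "z \<in> R" "norm z = 1" "f z = (z \<bullet> f z) *\<^sub>R z"
    "\<And>x. x \<in> R \<Longrightarrow> (z \<bullet> f z) * (norm x)\<^sup>2 \<le> x \<bullet> f x"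
proof -
  have compact: "compact (sphere 0 1 \<inter> R)"
    using closed_subspace[OF R(1)] by (intro compact_Int_closed) auto
  obtain x0 where x0: "x0 \<in> R" "x0 \<noteq> 0"
    using R(3) subspace_0[OF R(1)] by blast
  have "(1 / norm x0) *\<^sub>R x0 \<in> sphere 0 1 \<inter> R"
    using x0 R(1) by (auto simp: subspace_scale)
  then have ne: "sphere 0 1 \<inter> R \<noteq> {}" by blast
  have "continuous_on (sphere 0 1 \<inter> R) (\<lambda>x. x \<bullet> f x)"
    using lin by (intro continuous_on_inner continuous_on_id linear_continuous_on) (simp add: linear_linear)
  from continuous_attains_inf[OF compact ne this]
  obtain z where z: "z \<in> R" "norm z = 1"
    and zmin: "\<And>y. y \<in> R \<Longrightarrow> norm y = 1 \<Longrightarrow> z \<bullet> f z \<le> y \<bullet> f y" by auto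
  define m where "m = z \<bullet> f z"
  have min: "m * (norm x)\<^sup>2 \<le> x \<bullet> f x" if "x \<in> R" for x
  proof (cases "x = 0")
    case False
    have "m \<le> ((1 / norm x) *\<^sub>R x) \<bullet> f ((1 / norm x) *\<^sub>R x)"
      unfolding m_def using that False R(1) by (intro zmin) (auto simp: subspace_scale)
    also have "\<dots> = (x \<bullet> f x) / (norm x)\<^sup>2"
      by (simp add: linear_scale[OF lin] power2_eq_square)
    finally show ?thesis using False by (simp add: field_simps)
  qed (simp add: linear_0[OF lin])
  define w where "w = f z - m *\<^sub>R z"
  have wR: "w \<in> R"
    unfolding w_def using z(1) R by (intro subspace_diff subspace_scale) auto
  \<comment> \<open>Moving from the minimizer along minus its residual would lower the form to first order.\<close>
  have "2 * (norm w)\<^sup>2 \<le> 0"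
  proof (rule nonpos_if_first_order_le_second_order)
    fix s :: real
    let ?y = "z - s *\<^sub>R w"
    have "?y \<in> R" using z(1) wR R(1) by (intro subspace_diff subspace_scale)
    from min[OF this] have le: "m * (?y \<bullet> ?y) \<le> ?y \<bullet> f ?y"
      by (simp add: power2_norm_eq_inner)
    have fw: "f z = w + m *\<^sub>R z" by (simp add: w_def)
    have zfw: "z \<bullet> f w = w \<bullet> w + m * (w \<bullet> z)"
      unfolding sym[symmetric] fw by (simp add: inner_add inner_commute)
    have zz: "z \<bullet> z = 1" using z(2) by (simp add: norm_eq_1)
    have zw: "z \<bullet> w = 0" by (simp add: w_def inner_diff zz m_def)
    have "?y \<bullet> f ?y = m - 2 * s * (w \<bullet> w) + s\<^sup>2 * (w \<bullet> f w)"
      using zw by (simp add: linear_diff[OF lin] linear_scale[OF lin] fw zfw inner_diff inner_add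
         zz inner_commute[of w z] power2_eq_square algebra_simps)
    moreover have "?y \<bullet> ?y = 1 + s\<^sup>2 * (w \<bullet> w)"
      using zw by (simp add: inner_diff zz inner_commute[of w z] power2_eq_square)
    ultimately show "s * (2 * (norm w)\<^sup>2) \<le> s\<^sup>2 * (w \<bullet> f w - m * (w \<bullet> w))"
      using le by (simp add: power2_norm_eq_inner algebra_simps)
  qed
  then have "w = 0" by simp
  then show ?thesis using that[of z] z min by (simp add: w_def m_def)
qed

text \<open>
  Split off one Rayleigh minimizer; its orthogonal complement in \<open>R\<close> is again invariant, by symmetry, and
  has smaller dimension.
\<close>

lemma orthonormal_eigenbasis:
  fixes f :: "'a::euclidean_space \<Rightarrow> 'a"
  assumes lin: "linear f" and sym: "\<And>x y. f x \<bullet> y = x \<bullet> f y"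
    and "subspace R" "f ` R \<subseteq> R"
  shows "\<exists>B. pairwise orthogonal B \<and> (\<forall>b\<in>B. norm b = 1 \<and> f b = (b \<bullet> f b) *\<^sub>R b) \<and> span B = R"
  using assms(3,4)
proof (induction "dim R" arbitrary: R rule: less_induct)
  case less
  show ?case
  proof (cases "R = {0}")
    case True
    then show ?thesis by (intro exI[of _ "{}"]) auto
  next
    case False
    obtain z where z: "z \<in> R" "norm z = 1" "f z = (z \<bullet> f z) *\<^sub>R z"
      using rayleigh_minimizer_is_eigenvector[OF lin sym less.prems False] by metis
    define R' where "R' = {x \<in> R. x \<bullet> z = 0}"
    have sub: "subspace R'"
      using less.prems(1) by (auto simp: R'_def subspace_def inner_add_left)
    have inv: "f ` R' \<subseteq> R'"
    proof clarify
      fix x assume x: "x \<in> R'"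
      have "f x \<bullet> z = x \<bullet> ((z \<bullet> f z) *\<^sub>R z)" using sym z(3) by metis
      then show "f x \<in> R'" using x less.prems(2) by (auto simp: R'_def)
    qed
    have "z \<notin> R'" using z(2) by (auto simp: R'_def)
    then have "R' \<noteq> R" using z(1) by auto
    moreover have "R' \<subseteq> R" by (auto simp: R'_def)
    ultimately have "R' \<subset> R" by blast
    then have "dim R' < dim R"
      using sub less.prems(1) by (intro dim_psubset) (simp add: span_eq_iff[THEN iffD2])
    from less.hyps[OF this sub inv] obtain B where B: "pairwise orthogonal B"
      "\<forall>b\<in>B. norm b = 1 \<and> f b = (b \<bullet> f b) *\<^sub>R b" "span B = R'" by blast
    have "R \<subseteq> span (insert z B)"
    proof
      fix x assume x: "x \<in> R"
      have "x - (x \<bullet> z) *\<^sub>R z \<in> R'"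
        using x z less.prems(1)
        by (auto simp: R'_def inner_diff_left norm_eq_1 intro!: subspace_diff subspace_scale)
      then show "x \<in> span (insert z B)" using B(3) by (auto simp: span_insert)
    qed
    moreover have "span (insert z B) \<subseteq> R"
      using z(1) B(3) span_superset[of B] less.prems(1)
      by (intro span_minimal) (auto simp: R'_def)
    moreover have "\<forall>b\<in>B. orthogonal b z"
      using B(3) span_superset[of B] by (auto simp: R'_def orthogonal_def)
    then have "pairwise orthogonal (insert z B)"
      using B(1) by (auto simp: pairwise_insert orthogonal_commute)
    ultimately show ?thesis
      using B(2) z by (intro exI[of _ "insert z B"]) auto
  qed
qed

text \<open>
  For a self-adjoint map the polarization identity recovers \<open>f x \<bullet> y\<close> from the quadratic form. Taking
  for \<open>y\<close> the vector in the direction of \<open>f x\<close> with the same length as \<open>x\<close> makes the parallelogram law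
  return exactly the bound of the form, without a spectral decomposition.
\<close>

lemma norm_le_of_quadratic_form:
  fixes f :: "'a::real_inner \<Rightarrow> 'a"
  assumes lin: "linear f" and sym: "\<And>x y. f x \<bullet> y = x \<bullet> f y"
    and R: "subspace R" "f ` R \<subseteq> R"
    and form: "\<And>x. x \<in> R \<Longrightarrow> \<bar>x \<bullet> f x\<bar> \<le> r * (norm x)\<^sup>2"
    and x: "x \<in> R"
  shows "norm (f x) \<le> r * norm x"
proof (cases "x = 0 \<or> f x = 0")
  case True
  then show ?thesis
  proof
    assume "f x = 0"
    then show ?thesis using form[OF x]
      by (cases "x = 0") (auto simp: zero_le_mult_iff)
  qed (simp add: linear_0[OF lin])
next
  case False
  define y where "y = (norm x / norm (f x)) *\<^sub>R f x"
  have y: "y \<in> R" "norm y = norm x"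
    using R x False by (auto simp: y_def intro!: subspace_scale)
  have "x \<bullet> f y = f x \<bullet> y" "y \<bullet> f x = f x \<bullet> y"
    by (simp_all only: sym inner_commute[of y])
  then have "4 * (f x \<bullet> y) = (x + y) \<bullet> f (x + y) - (x - y) \<bullet> f (x - y)"
    by (simp add: linear_add[OF lin] linear_diff[OF lin] inner_add inner_diff)
  also have "\<dots> \<le> r * (norm (x + y))\<^sup>2 + r * (norm (x - y))\<^sup>2"
    using form[of "x + y"] form[of "x - y"] x y(1) R(1)
    by (smt (verit) subspace_add subspace_diff)
  also have "\<dots> = 4 * r * (norm x)\<^sup>2"
    using y(2) by (simp add: power2_norm_eq_inner inner_add inner_diff norm_eq algebra_simps)
  finally have "f x \<bullet> y \<le> r * (norm x)\<^sup>2" by simp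
  moreover have "f x \<bullet> y = norm x * norm (f x)"
    using False by (simp add: y_def power2_norm_eq_inner[symmetric] power2_eq_square)
  ultimately show ?thesis using False by (simp add: power2_eq_square)
qed

section \<open>Symmetric and positive definite matrices\<close>

lemma inner_transpose_matrix_vector:
  "(transpose M *v x) \<bullet> y = x \<bullet> (M *v y)" for M :: "real ^ 'n ^ 'm"
  by (simp add: dot_lmul_matrix)

lemma mat_matrix_vector: "mat c *v x = c *\<^sub>R x" for x :: "real ^ 'n"
  by (simp add: vec_eq_iff matrix_vector_mult_def mat_def if_distrib[where f="\<lambda>x. x * _"] cong: if_cong)

lemma loewner_le_quadratic_form:
  assumes "A \<preceq>\<^sub>L B"
  shows "x \<bullet> (A *v x) \<le> x \<bullet> (B *v x)"
  using assms by (simp add: loewner_le_def pos_semidef_def matrix_vector_mult_diff_rdistrib inner_diff)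

lemma symmetric_matrix_inner:
  fixes A :: "real ^ 'n ^ 'n"
  assumes "transpose A = A"
  shows "(A *v x) \<bullet> y = x \<bullet> (A *v y)"
  by (metis assms inner_transpose_matrix_vector)

lemma pos_def_nonneg: "pos_def A \<Longrightarrow> 0 \<le> x \<bullet> (A *v x)"
  by (cases "x = 0") (auto simp: pos_def_def less_imp_le)

lemma norm_wrt_power2: "pos_def A \<Longrightarrow> (norm_wrt A x)\<^sup>2 = x \<bullet> (A *v x)"
  by (simp add: norm_wrt_def pos_def_nonneg)

text \<open>
  In an orthonormal eigenbasis, take square roots of the eigenvalues.
\<close>

lemma pos_def_square_root_exists:
  fixes A :: "real ^ 'n ^ 'n"
  assumes A: "pos_def A"
  shows "\<exists>S. pos_def S \<and> S ** S = A"
proof -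
  have "\<exists>B. pairwise orthogonal B \<and> (\<forall>b\<in>B. norm b = 1 \<and> A *v b = (b \<bullet> (A *v b)) *\<^sub>R b) \<and> span B = UNIV"
    using A by (intro orthonormal_eigenbasis) (auto simp: pos_def_def symmetric_matrix_inner)
  then obtain B where B: "pairwise orthogonal B" "span B = UNIV"
    and nB: "\<And>b. b \<in> B \<Longrightarrow> norm b = 1" and ev: "\<And>b. b \<in> B \<Longrightarrow> A *v b = (b \<bullet> (A *v b)) *\<^sub>R b"
    by blast
  define c where "c b = sqrt (b \<bullet> (A *v b))" for b
  define f where "f x = (\<Sum>b\<in>B. (c b * (b \<bullet> x)) *\<^sub>R b)" for x
  have finB: "finite B" using B(1) by (rule pairwise_orthogonal_imp_finite)
  have cpos: "c b > 0" if "b \<in> B" for b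
  proof -
    have "b \<noteq> 0" using nB[OF that] by auto
    then show ?thesis using A by (simp add: c_def pos_def_def)
  qed
  have lin: "linear f"
    unfolding f_def
    by (intro linear_compose_sum ballI)
       (auto intro!: linearI simp: inner_add_right algebra_simps)
  have mf: "matrix f *v x = f x" for x by (rule fun_cong[OF matrix_vector_mul(2)[OF lin]])
  have sym: "f x \<bullet> y = x \<bullet> f y" for x y
    by (simp add: f_def inner_sum_left inner_sum_right inner_commute mult.commute mult.left_commute)
  have fb: "f b = c b *\<^sub>R b" if "b \<in> B" for b
  proof -
    have "f b = (\<Sum>b'\<in>B. if b' = b then c b *\<^sub>R b else 0)"
      unfolding f_def
    proof (rule sum.cong)
      fix b' assume "b' \<in> B"
      then show "(c b' * (b' \<bullet> b)) *\<^sub>R b' = (if b' = b then c b *\<^sub>R b else 0)"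
        using nB[OF that] that B(1) by (auto simp: norm_eq_1 pairwise_def orthogonal_def)
    qed simp
    then show ?thesis using finB that by simp
  qed
  have ff: "f (f x) = A *v x" for x
  proof (rule linear_eq_on_span[of "f \<circ> f" "(*v) A" B x, unfolded o_def])
    show "linear (\<lambda>x. f (f x))" using linear_compose[OF lin lin] by (simp add: o_def)
    fix b assume b: "b \<in> B"
    then have "f (f b) = (c b)\<^sup>2 *\<^sub>R b"
      by (simp add: fb linear_scale[OF lin] power2_eq_square)
    also have "\<dots> = (b \<bullet> (A *v b)) *\<^sub>R b"
      using pos_def_nonneg[OF A, of b] by (simp add: c_def)
    also have "\<dots> = A *v b"
      by (rule ev[OF b, symmetric])
    finally show "f (f b) = A *v b" .
  qed (use B in auto)
  have pos: "0 < x \<bullet> f x" if "x \<noteq> 0" for x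
  proof -
    obtain b where b: "b \<in> B" "b \<bullet> x \<noteq> 0"
    proof (rule ccontr)
      assume "\<not> thesis"
      then have "\<forall>b\<in>B. orthogonal x b" using that by (auto simp: orthogonal_def inner_commute)
      then have "orthogonal x x" using B(2) by (auto intro: orthogonal_to_span[of _ B])
      then show False using \<open>x \<noteq> 0\<close> by (simp add: orthogonal_def)
    qed
    have eq: "x \<bullet> f x = (\<Sum>b\<in>B. c b * (b \<bullet> x)\<^sup>2)"
      by (simp add: f_def inner_sum_right inner_commute power2_eq_square mult.assoc)
    show ?thesis unfolding eq
      using b cpos finB by (intro sum_pos2[of B b]) (auto simp: less_imp_le)
  qed
  have "transpose (matrix f) = matrix f"
    unfolding matrix_eq
  proof
    fix x
    have "(transpose (matrix f) *v x - matrix f *v x) \<bullet> y = 0" for y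
      unfolding inner_diff_left inner_transpose_matrix_vector mf using sym by simp
    then show "transpose (matrix f) *v x = matrix f *v x"
      using inner_eq_zero_iff right_minus_eq by blast
  qed
  moreover have "matrix f ** matrix f = A"
    unfolding matrix_eq by (simp add: matrix_vector_mul_assoc[symmetric] mf ff)
  ultimately show ?thesis using pos by (intro exI[of _ "matrix f"]) (auto simp: pos_def_def mf)
qed

text \<open>
  If \<open>b\<close> is an eigenvector of \<open>S'\<close> with eigenvalue \<open>c > 0\<close>, then \<open>w = S b - c b\<close> satisfies
  \<open>S w = - c w\<close>, which positive definiteness of \<open>S\<close> allows only for \<open>w = 0\<close>. So the two roots agree on an
  eigenbasis of \<open>S'\<close>.
\<close>

lemma pos_def_square_root_unique:
  fixes S S' :: "real ^ 'n ^ 'n"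
  assumes S: "pos_def S" and S': "pos_def S'" and eq: "S ** S = S' ** S'"
  shows "S = S'"
proof -
  have "\<exists>B. pairwise orthogonal B \<and> (\<forall>b\<in>B. norm b = 1 \<and> S' *v b = (b \<bullet> (S' *v b)) *\<^sub>R b) \<and> span B = UNIV"
    using S' by (intro orthonormal_eigenbasis) (auto simp: pos_def_def symmetric_matrix_inner)
  then obtain B where B: "span B = UNIV" and nB: "\<And>b. b \<in> B \<Longrightarrow> norm b = 1"
    and ev: "\<And>b. b \<in> B \<Longrightarrow> S' *v b = (b \<bullet> (S' *v b)) *\<^sub>R b" by blast
  have "S *v b = S' *v b" if b: "b \<in> B" for b
  proof -
    define c where "c = b \<bullet> (S' *v b)"
    have c: "S' *v b = c *\<^sub>R b" unfolding c_def by (rule ev[OF b])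
    have "b \<noteq> 0" using nB[OF b] by auto
    then have "c > 0" unfolding c_def using S' by (simp add: pos_def_def)
    define w where "w = S *v b - c *\<^sub>R b"
    have "S *v (S *v b) = S' *v (S' *v b)" by (simp add: matrix_vector_mul_assoc eq)
    also have "\<dots> = c *\<^sub>R (c *\<^sub>R b)"
      by (simp only: c matrix_vector_mult_scaleR)
    finally have "S *v w = - (c *\<^sub>R w)"
      by (simp add: w_def matrix_vector_mult_diff_distrib matrix_vector_mult_scaleR scaleR_diff_right)
    then have "w \<bullet> (S *v w) = - c * (w \<bullet> w)" by simp
    then have "w = 0" using S \<open>c > 0\<close> pos_def_nonneg[OF S, of w]
      by (metis inner_gt_zero_iff mult_minus_left mult_pos_pos neg_0_le_iff_le not_less)
    then show ?thesis using c by (simp add: w_def)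
  qed
  then have "S *v x = S' *v x" for x
    using linear_eq_on_span[of "(*v) S" "(*v) S'" B x] B by auto
  then show ?thesis by (simp add: matrix_eq)
qed

lemma matrix_sqrt:
  assumes "pos_def A"
  shows "pos_def (matrix_sqrt A)" "matrix_sqrt A ** matrix_sqrt A = A"
proof -
  have "\<exists>!S. pos_def S \<and> S ** S = A"
    using pos_def_square_root_exists[OF assms] pos_def_square_root_unique by metis
  from theI'[OF this] show "pos_def (matrix_sqrt A)" "matrix_sqrt A ** matrix_sqrt A = A"
    by (auto simp: matrix_sqrt_def)
qed

lemma pos_def_invertible:
  assumes "pos_def S"
  shows "invertible S"
proof -
  have "\<forall>x. S *v x = 0 \<longrightarrow> x = 0"
    using assms by (metis inner_zero_right less_irrefl pos_def_def)
  then show ?thesis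
    by (simp add: invertible_left_inverse matrix_left_invertible_ker)
qed

lemma matrix_inv_sqrt_cancel:
  assumes "pos_def A"
  shows "matrix_inv_sqrt A *v (matrix_sqrt A *v x) = x" "matrix_sqrt A *v (matrix_inv_sqrt A *v x) = x"
proof -
  let ?S = "matrix_sqrt A"
  have "\<exists>M. ?S ** M = mat 1 \<and> M ** ?S = mat 1"
    using pos_def_invertible[OF matrix_sqrt(1)[OF assms]] by (simp add: invertible_def)
  from someI_ex[OF this] show "matrix_inv_sqrt A *v (?S *v x) = x" "?S *v (matrix_inv_sqrt A *v x) = x"
    by (simp_all add: matrix_inv_sqrt_def matrix_vector_mul_assoc matrix_inv_def)
qed

lemma matrix_inv_sqrt_symmetric:
  assumes "pos_def A"
  shows "(matrix_inv_sqrt A *v x) \<bullet> y = x \<bullet> (matrix_inv_sqrt A *v y)"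
  using symmetric_matrix_inner[of "matrix_sqrt A"] matrix_sqrt(1)[OF assms]
  by (metis assms matrix_inv_sqrt_cancel(2) pos_def_def)

lemma norm_wrt_eq_norm_matrix_sqrt:
  assumes "pos_def A"
  shows "norm_wrt A x = norm (matrix_sqrt A *v x)"
proof -
  let ?S = "matrix_sqrt A"
  have "x \<bullet> (A *v x) = x \<bullet> (?S *v (?S *v x))"
    by (simp add: matrix_vector_mul_assoc matrix_sqrt(2)[OF assms])
  also have "\<dots> = (?S *v x) \<bullet> (?S *v x)"
    using matrix_sqrt(1)[OF assms] by (simp add: symmetric_matrix_inner pos_def_def)
  finally show ?thesis by (simp add: norm_wrt_def norm_eq_sqrt_inner)
qed

text \<open>
  Expansion in an orthonormal basis of \<open>U\<close> gives a matrix with the defining property of the projection;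
  it is the only one, since the difference of two candidates maps into \<open>U\<close> and is orthogonal to \<open>U\<close>.
\<close>

lemma orth_proj:
  fixes U :: "(real ^ 'n) set"
  assumes U: "subspace U"
  shows "orth_proj U *v x \<in> U" "y \<in> U \<Longrightarrow> (orth_proj U *v x) \<bullet> y = x \<bullet> y"
proof -
  obtain B where B: "B \<subseteq> U" "pairwise orthogonal B" "\<And>b. b \<in> B \<Longrightarrow> norm b = 1" "span B = U"
    using orthonormal_basis_subspace[OF U] by metis
  have finB: "finite B" using B(2) by (rule pairwise_orthogonal_imp_finite)
  define f where "f x = (\<Sum>b\<in>B. (b \<bullet> x) *\<^sub>R b)" for x
  have lin: "linear f"
    unfolding f_def
    by (intro linear_compose_sum ballI) (auto intro!: linearI simp: inner_add_right algebra_simps)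
  have mf: "matrix f *v x = f x" for x by (rule fun_cong[OF matrix_vector_mul(2)[OF lin]])
  have fU: "f x \<in> U" for x
    unfolding f_def using B(1) U by (intro subspace_sum subspace_scale) auto
  have orth: "(x - f x) \<bullet> y = 0" if "y \<in> U" for x y
  proof -
    have "orthogonal (x - f x) b" if b: "b \<in> B" for b
    proof -
      have "f x \<bullet> b = (\<Sum>b'\<in>B. if b' = b then b \<bullet> x else 0)"
        unfolding f_def inner_sum_left
      proof (rule sum.cong)
        fix b' assume "b' \<in> B"
        then show "((b' \<bullet> x) *\<^sub>R b') \<bullet> b = (if b' = b then b \<bullet> x else 0)"
          using B(3)[OF b] b B(2) by (auto simp: norm_eq_1 pairwise_def orthogonal_def)
      qed simp
      then show ?thesis using finB b by (simp add: orthogonal_def inner_diff inner_commute)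
    qed
    then have "orthogonal (x - f x) y" using that B(4) by (auto intro: orthogonal_to_span[of _ B])
    then show ?thesis by (simp add: orthogonal_def)
  qed
  let ?is_proj = "\<lambda>P. \<forall>x. P *v x \<in> U \<and> (\<forall>y\<in>U. (x - P *v x) \<bullet> y = 0)"
  have "\<exists>!P. ?is_proj P"
  proof (rule ex1I)
    show "?is_proj (matrix f)" using fU orth by (simp add: mf)
    fix P assume P: "?is_proj P"
    have "P *v x - f x = 0" for x
    proof -
      let ?d = "P *v x - f x"
      have d: "?d \<in> U" using P fU U by (intro subspace_diff) auto
      have "?d \<bullet> ?d = (x - f x) \<bullet> ?d - (x - P *v x) \<bullet> ?d"
        by (simp add: inner_diff)
      also have "\<dots> = 0" using P d orth[OF d] by simp
      finally show ?thesis by simp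
    qed
    then show "P = matrix f" unfolding matrix_eq mf by simp
  qed
  from theI'[OF this] have P: "?is_proj (orth_proj U)" by (simp add: orth_proj_def)
  then show "orth_proj U *v x \<in> U" by blast
  show "(orth_proj U *v x) \<bullet> y = x \<bullet> y" if "y \<in> U"
    using P that by (metis inner_diff_left right_minus_eq)
qed

section \<open>Singular values\<close>

text \<open>
  Eigenvectors of the Gram matrix for different eigenvalues are orthogonal, and a finite-dimensional space
  contains only finitely many pairwise orthogonal nonzero vectors. Finiteness is what gives meaning to
  the maximum and minimum that define the extreme singular values.
\<close>

lemma finite_singular_values: "finite (singular_values M)"
proof -
  let ?A = "transpose M ** M"
  have sym: "(?A *v x) \<bullet> y = x \<bullet> (?A *v y)" for x y
    by (rule symmetric_matrix_inner) (simp add: matrix_transpose_mul transpose_transpose)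
  have "\<forall>s\<in>singular_values M. \<exists>v. v \<noteq> 0 \<and> ?A *v v = s\<^sup>2 *\<^sub>R v"
    by (auto simp: singular_values_def)
  then obtain v where v: "\<And>s. s \<in> singular_values M \<Longrightarrow> v s \<noteq> 0"
    "\<And>s. s \<in> singular_values M \<Longrightarrow> ?A *v v s = s\<^sup>2 *\<^sub>R v s" by metis
  have orth: "v s \<bullet> v s' = 0"
    if "s \<in> singular_values M" "s' \<in> singular_values M" "s \<noteq> s'" for s s'
  proof -
    have "s\<^sup>2 * (v s \<bullet> v s') = s'\<^sup>2 * (v s \<bullet> v s')"
      using sym[of "v s" "v s'"] v(2)[OF that(1)] v(2)[OF that(2)] by simp
    moreover have "s\<^sup>2 \<noteq> s'\<^sup>2"
      using that by (auto simp: singular_values_def)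
    ultimately show ?thesis by simp
  qed
  have "inj_on v (singular_values M)"
    by (rule inj_onI) (metis orth v(1) inner_eq_zero_iff)
  moreover have "pairwise orthogonal (v ` singular_values M)"
    by (auto simp: pairwise_def orthogonal_def intro!: orth)
  then have "finite (v ` singular_values M)" by (rule pairwise_orthogonal_imp_finite)
  ultimately show ?thesis using finite_imageD by blast
qed

text \<open>
  Singular values are defined by \<open>B\<^sup>T B\<close>, whereas the error lives in the range of \<open>B\<close>, on which
  \<open>B B\<^sup>T\<close> acts; \<open>B\<^sup>T\<close> carries eigenvectors of the latter to eigenvectors of the former.
\<close>

lemma sqrt_gram_eigenvalue_singular:
  fixes B :: "real ^ 'v ^ 'e"
  assumes z: "B *v (transpose B *v z) = m *\<^sub>R z" and m: "0 \<le> m" and nz: "transpose B *v z \<noteq> 0"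
  shows "sqrt m \<in> singular_values B"
proof -
  let ?v = "transpose B *v z"
  have "(transpose B ** B) *v ?v = transpose B *v (m *\<^sub>R z)"
    unfolding matrix_vector_mul_assoc[symmetric] z ..
  also have "\<dots> = (sqrt m)\<^sup>2 *\<^sub>R ?v" using m by (simp only: matrix_vector_mult_scaleR real_sqrt_pow2)
  finally show ?thesis using nz m unfolding singular_values_def by auto
qed

lemma nonzero_matrix_range:
  fixes B :: "real ^ 'v ^ 'e"
  assumes "B \<noteq> 0"
  shows "\<exists>z\<in>range ((*v) B). z \<noteq> 0"
proof (rule ccontr)
  assume "\<not> ?thesis"
  then have "B *v x = 0 *v x" for x by auto
  then have "B = 0" unfolding matrix_eq by blast
  then show False using assms by simp
qed

lemma transpose_nonzero_on_range:
  fixes B :: "real ^ 'v ^ 'e"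
  assumes "z \<in> range ((*v) B)" "z \<noteq> 0"
  shows "transpose B *v z \<noteq> 0"
proof
  assume 0: "transpose B *v z = 0"
  obtain y where y: "z = B *v y" using assms(1) by blast
  have "z \<bullet> z = (transpose B *v z) \<bullet> y"
    unfolding inner_transpose_matrix_vector y ..
  then show False using 0 assms(2) by simp
qed

text \<open>
  The extreme values of \<open>\<parallel>B\<^sup>T x\<parallel>\<^sup>2\<close> on the unit sphere of the range of \<open>B\<close> are eigenvalues of
  \<open>B B\<^sup>T\<close>, hence squares of singular values. The smaller one is positive because \<open>B\<^sup>T\<close> is injective on
  the range of \<open>B\<close>, so it is at least the square of the smallest positive singular value.
\<close>

lemma singular_value_bounds_on_range:
  fixes B :: "real ^ 'v ^ 'e"
  assumes "B \<noteq> 0"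
  shows "0 < sigma_min_pos B" (is ?pos)
    and "x \<in> range ((*v) B) \<Longrightarrow> (sigma_min_pos B)\<^sup>2 * (norm x)\<^sup>2 \<le> (norm (transpose B *v x))\<^sup>2" (is "_ \<Longrightarrow> ?lo")
    and "x \<in> range ((*v) B) \<Longrightarrow> (norm (transpose B *v x))\<^sup>2 \<le> (sigma_max B)\<^sup>2 * (norm x)\<^sup>2" (is "_ \<Longrightarrow> ?hi")
proof -
  let ?R = "range ((*v) B)"
  define f where "f z = B *v (transpose B *v z)" for z
  have lin: "linear f"
    unfolding f_def using linear_compose[of "(*v) (transpose B)" "(*v) B"]
    by (simp add: o_def del: transpose_matrix_vector)
  have form: "y \<bullet> f x = (transpose B *v y) \<bullet> (transpose B *v x)" for x y
    unfolding f_def inner_transpose_matrix_vector ..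
  have sym: "f x \<bullet> y = x \<bullet> f y" for x y
    using form[of x y] form[of y x] by (simp add: inner_commute del: transpose_matrix_vector)
  have form2: "x \<bullet> f x = (norm (transpose B *v x))\<^sup>2" for x
    unfolding form power2_norm_eq_inner ..
  have R: "subspace ?R" by (intro linear_subspace_image) auto
  have inv: "f ` ?R \<subseteq> ?R" by (auto simp: f_def)
  have Rne: "?R \<noteq> {0}" using nonzero_matrix_range[OF assms] by auto
  have fin: "finite (singular_values B)" by (rule finite_singular_values)
  obtain z where z: "z \<in> ?R" "norm z = 1" "f z = (z \<bullet> f z) *\<^sub>R z"
    "\<And>x. x \<in> ?R \<Longrightarrow> (z \<bullet> f z) * (norm x)\<^sup>2 \<le> x \<bullet> f x"
    using rayleigh_minimizer_is_eigenvector[OF lin sym R inv Rne] by metis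
  have nz: "transpose B *v z \<noteq> 0" using z(1,2) by (intro transpose_nonzero_on_range) auto
  have mpos: "z \<bullet> f z > 0" unfolding form2 using nz by simp
  have sv: "sqrt (z \<bullet> f z) \<in> {s \<in> singular_values B. 0 < s}"
    using sqrt_gram_eigenvalue_singular[OF z(3)[unfolded f_def] _ nz] mpos
    unfolding f_def by simp
  have "sigma_min_pos B \<in> {s \<in> singular_values B. 0 < s}"
    unfolding sigma_min_pos_def using fin sv by (intro Min_in) auto
  then show ?pos by simp
  have "sigma_min_pos B \<le> sqrt (z \<bullet> f z)"
    unfolding sigma_min_pos_def using fin sv by (intro Min_le) auto
  then have "(sigma_min_pos B)\<^sup>2 \<le> (sqrt (z \<bullet> f z))\<^sup>2"
    using \<open>?pos\<close> by (intro power_mono) auto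
  then have le: "(sigma_min_pos B)\<^sup>2 \<le> z \<bullet> f z" using mpos by simp
  show ?lo if "x \<in> ?R"
    using mult_right_mono[OF le, of "(norm x)\<^sup>2"] z(4)[OF that] unfolding form2 by simp
  \<comment> \<open>A Rayleigh maximizer of \<open>f\<close> is a minimizer of \<open>-f\<close>.\<close>
  obtain z where z: "z \<in> ?R" "norm z = 1" "- f z = (z \<bullet> - f z) *\<^sub>R z"
    "\<And>x. x \<in> ?R \<Longrightarrow> (z \<bullet> - f z) * (norm x)\<^sup>2 \<le> x \<bullet> - f x"
  proof (rule rayleigh_minimizer_is_eigenvector[of "\<lambda>x. - f x" ?R])
    show "linear (\<lambda>x. - f x)" using lin by (rule linear_compose_neg)
    show "(\<lambda>x. - f x) ` ?R \<subseteq> ?R" using inv R by (auto intro!: subspace_neg)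
  qed (use sym R Rne in auto)
  have nz: "transpose B *v z \<noteq> 0" using z(1,2) by (intro transpose_nonzero_on_range) auto
  have mpos: "z \<bullet> f z > 0" unfolding form2 using nz by simp
  have ev: "f z = (z \<bullet> f z) *\<^sub>R z" using z(3) by simp
  have sv: "sqrt (z \<bullet> f z) \<in> singular_values B"
    using sqrt_gram_eigenvalue_singular[OF ev[unfolded f_def] _ nz] mpos
    unfolding f_def by simp
  have "sqrt (z \<bullet> f z) \<le> sigma_max B"
    unfolding sigma_max_def using fin sv by (intro Max_ge) auto
  then have "(sqrt (z \<bullet> f z))\<^sup>2 \<le> (sigma_max B)\<^sup>2"
    using mpos by (intro power_mono) auto
  then have le: "z \<bullet> f z \<le> (sigma_max B)\<^sup>2" using mpos by simp
  show ?hi if "x \<in> ?R"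
    using mult_right_mono[OF le, of "(norm x)\<^sup>2"] z(4)[OF that] unfolding form2[symmetric] by simp
qed

section \<open>Proximal steps on the box\<close>

lemma infnorm_le_iff_components: "infnorm x \<le> c \<longleftrightarrow> (\<forall>i. \<bar>x $ i\<bar> \<le> c)" for x :: "real ^ 'n"
  by (auto simp: infnorm_Max Basis_vec_def inner_axis)

text \<open>
  Along the segment from the minimizer to \<open>q\<close>, which stays in the box, the objective is a quadratic
  polynomial whose linear coefficient cannot be negative.
\<close>

lemma box_prox_variational_inequality:
  fixes y p g q :: "real ^ 'n"
  assumes T: "pos_def T"
    and y: "is_arg_min (\<lambda>q. - (g \<bullet> q) + t / 2 * (norm_wrt T (q - p))\<^sup>2) (\<lambda>q. infnorm q \<le> 1) y"
    and q: "infnorm q \<le> 1"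
  shows "(g - t *\<^sub>R (T *v (y - p))) \<bullet> (q - y) \<le> 0"
proof (rule nonpos_if_first_order_le_second_order)
  fix s :: real
  assume s: "0 < s" "s \<le> 1"
  define d where "d = q - y"
  let ?q = "y + s *\<^sub>R d"
  have ybox: "infnorm y \<le> 1"
    and ymin: "infnorm q' \<le> 1 \<Longrightarrow> - (g \<bullet> y) + t / 2 * (norm_wrt T (y - p))\<^sup>2
        \<le> - (g \<bullet> q') + t / 2 * (norm_wrt T (q' - p))\<^sup>2" for q'
    using y by (auto simp: is_arg_min_linorder)
  have "infnorm ?q = infnorm ((1 - s) *\<^sub>R y + s *\<^sub>R q)"
    by (simp add: d_def algebra_simps)
  also have "\<dots> \<le> (1 - s) * infnorm y + s * infnorm q"
    using s by (intro order.trans[OF infnorm_triangle]) (simp add: infnorm_mul)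
  also have "\<dots> \<le> 1"
    using s q ybox by (intro convex_bound_le) auto
  finally have "infnorm ?q \<le> 1" .
  note le = ymin[OF this]
  have sym: "(y - p) \<bullet> (T *v d) = d \<bullet> (T *v (y - p))"
    using T by (metis inner_commute pos_def_def symmetric_matrix_inner)
  have "(norm_wrt T (?q - p))\<^sup>2 = ((y - p) + s *\<^sub>R d) \<bullet> (T *v ((y - p) + s *\<^sub>R d))"
    by (simp add: norm_wrt_power2[OF T] algebra_simps)
  also have "\<dots> = (y - p) \<bullet> (T *v (y - p)) + 2 * s * (d \<bullet> (T *v (y - p))) + s\<^sup>2 * (d \<bullet> (T *v d))"
    by (simp only: matrix_vector_right_distrib matrix_vector_mult_scaleR inner_add_left inner_add_right
        inner_scaleR_left inner_scaleR_right sym) (simp add: power2_eq_square algebra_simps)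
  finally have "(norm_wrt T (?q - p))\<^sup>2 =
      (norm_wrt T (y - p))\<^sup>2 + 2 * s * (d \<bullet> (T *v (y - p))) + s\<^sup>2 * (d \<bullet> (T *v d))"
    by (simp only: norm_wrt_power2[OF T])
  from le[unfolded this]
  show "s * ((g - t *\<^sub>R (T *v (y - p))) \<bullet> (q - y)) \<le> s\<^sup>2 * (t / 2 * (d \<bullet> (T *v d)))"
    unfolding d_def[symmetric]
    by (simp add: inner_diff_left inner_diff_right inner_add_right inner_commute[of _ d] field_simps)
qed

text \<open>
  The constraints are separable, so the variational inequality may be tested by moving one coordinate
  at a time.
\<close>

lemma box_prox_optimality:
  fixes y p g :: "real ^ 'n"
  assumes T: "pos_def T"
    and y: "is_arg_min (\<lambda>q. - (g \<bullet> q) + t / 2 * (norm_wrt T (q - p))\<^sup>2) (\<lambda>q. infnorm q \<le> 1) y"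
  shows "(g - t *\<^sub>R (T *v (y - p))) $ e > 0 \<Longrightarrow> y $ e = 1"
    and "(g - t *\<^sub>R (T *v (y - p))) $ e < 0 \<Longrightarrow> y $ e = -1"
proof -
  have ybox: "\<bar>y $ i\<bar> \<le> 1" for i
    using y by (simp add: is_arg_min_def infnorm_le_iff_components)
  have key: "(g - t *\<^sub>R (T *v (y - p))) $ e * (c - y $ e) \<le> 0" if "\<bar>c\<bar> \<le> 1" for c
  proof -
    let ?q = "y + axis e (c - y $ e)"
    have "\<bar>?q $ i\<bar> \<le> 1" for i
      using ybox[of i] that by (simp add: axis_def)
    then have "infnorm ?q \<le> 1" unfolding infnorm_le_iff_components by blast
    from box_prox_variational_inequality[OF T y this] show ?thesis
      by (simp add: inner_axis)
  qed
  show "y $ e = 1" if "(g - t *\<^sub>R (T *v (y - p))) $ e > 0"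
    using key[of 1] that ybox[of e] by (auto simp: mult_le_0_iff)
  show "y $ e = -1" if "(g - t *\<^sub>R (T *v (y - p))) $ e < 0"
    using key[of "-1"] that ybox[of e] by (auto simp: mult_le_0_iff)
qed

text \<open>
  The residual of \<open>box_prox_optimality\<close> converges to \<open>g ps\<close>, since the steps tend to zero and the metrics
  are uniformly bounded. Where \<open>g ps\<close> is nonzero its sign eventually fixes the coordinate at \<open>1\<close> or \<open>-1\<close>, and
  then the limit has this value too; elsewhere strictness keeps the iterates off the boundary.
\<close>

lemma finite_identification:
  fixes g :: "real ^ 'n \<Rightarrow> real ^ 'n" and p :: "nat \<Rightarrow> real ^ 'n"
  assumes T: "\<And>k. pos_def (T k)" "\<And>k. T k \<preceq>\<^sub>L mat thi"
    and iter: "\<And>k. is_arg_min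
        (\<lambda>q. - (g (p k) \<bullet> q) + t / 2 * (norm_wrt (T k) (q - p k))\<^sup>2) (\<lambda>q. infnorm q \<le> 1) (p (Suc k))"
    and lim: "p \<longlonglongrightarrow> ps" and cont: "isCont g ps"
    and strict: "\<And>e. g ps $ e = 0 \<Longrightarrow> \<bar>ps $ e\<bar> < 1"
  shows "\<forall>\<^sub>F k in sequentially. active_set (p k) = active_set ps \<and> (\<forall>e\<in>active_set ps. p k $ e = ps $ e)"
    and "e \<notin> active_set ps \<Longrightarrow> g ps $ e = 0"
proof -
  have bound: "norm (T k *v x) \<le> thi * norm x" for k x
  proof (rule norm_le_of_quadratic_form[of "(*v) (T k)" UNIV])
    show "(T k *v x) \<bullet> y = x \<bullet> (T k *v y)" for x y
      using T(1) by (simp add: symmetric_matrix_inner pos_def_def)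
    show "\<bar>x \<bullet> (T k *v x)\<bar> \<le> thi * (norm x)\<^sup>2" for x
      using loewner_le_quadratic_form[OF T(2), of x k] pos_def_nonneg[OF T(1), of x k]
      by (simp add: mat_matrix_vector power2_norm_eq_inner)
  qed auto
  define r where "r k = g (p k) - t *\<^sub>R (T k *v (p (Suc k) - p k))" for k
  have "(\<lambda>k. p (Suc k) - p k) \<longlonglongrightarrow> 0"
    using tendsto_diff[OF LIMSEQ_Suc[OF lim] lim] by simp
  then have "(\<lambda>k. thi * norm (p (Suc k) - p k)) \<longlonglongrightarrow> 0"
    by (intro tendsto_mult_right_zero tendsto_norm_zero)
  then have "(\<lambda>k. T k *v (p (Suc k) - p k)) \<longlonglongrightarrow> 0"
    by (rule Lim_null_comparison[rotated]) (simp add: bound)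
  moreover have "(\<lambda>k. g (p k)) \<longlonglongrightarrow> g ps"
    using cont lim by (rule isCont_tendsto_compose)
  ultimately have "r \<longlonglongrightarrow> g ps"
    unfolding r_def by (auto intro!: tendsto_eq_intros)
  then have rlim: "(\<lambda>k. r k $ e) \<longlonglongrightarrow> g ps $ e" for e by (rule tendsto_vec_nth)
  have plim: "(\<lambda>k. p k $ e) \<longlonglongrightarrow> ps $ e" for e using lim by (rule tendsto_vec_nth)
  \<comment> \<open>A coordinate that is eventually constant has this constant as its limit.\<close>
  have settle: "ps $ e = c \<and> (\<forall>\<^sub>F k in sequentially. p k $ e = c)"
    if "\<forall>\<^sub>F k in sequentially. p (Suc k) $ e = c" for e c
  proof -
    have ev: "\<forall>\<^sub>F k in sequentially. p k $ e = c"
      using that by (subst (asm) eventually_sequentially_Suc)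
    then have "(\<lambda>k. p k $ e) \<longlonglongrightarrow> c" by (rule tendsto_eventually)
    then show ?thesis using ev plim[of e] LIMSEQ_unique by blast
  qed
  have active: "\<bar>ps $ e\<bar> = 1 \<and> (\<forall>\<^sub>F k in sequentially. p k $ e = ps $ e)" if "g ps $ e \<noteq> 0" for e
  proof (cases "g ps $ e > 0")
    case True
    have "\<forall>\<^sub>F k in sequentially. r k $ e > 0" using rlim True by (rule order_tendstoD)
    then have "\<forall>\<^sub>F k in sequentially. p (Suc k) $ e = 1"
      by eventually_elim (auto simp: r_def intro: box_prox_optimality(1)[OF T(1) iter])
    then show ?thesis using settle[of e 1] by auto
  next
    case False
    then have "g ps $ e < 0" using that by simp
    with rlim have "\<forall>\<^sub>F k in sequentially. r k $ e < 0" by (rule order_tendstoD)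
    then have "\<forall>\<^sub>F k in sequentially. p (Suc k) $ e = - 1"
      by eventually_elim (auto simp: r_def intro: box_prox_optimality(2)[OF T(1) iter])
    then show ?thesis using settle[of e "- 1"] by auto
  qed
  have inactive: "\<forall>\<^sub>F k in sequentially. \<bar>p k $ e\<bar> < 1" if "g ps $ e = 0" for e
    using tendsto_rabs[OF plim] strict[OF that] by (rule order_tendstoD)
  show "g ps $ e = 0" if "e \<notin> active_set ps"
    using active[of e] that by (auto simp: active_set_def)
  have "\<forall>\<^sub>F k in sequentially. \<forall>e. (\<bar>p k $ e\<bar> = 1 \<longleftrightarrow> \<bar>ps $ e\<bar> = 1) \<and> (\<bar>ps $ e\<bar> = 1 \<longrightarrow> p k $ e = ps $ e)"
  proof (rule eventually_all_finite)
    fix e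
    show "\<forall>\<^sub>F k in sequentially. (\<bar>p k $ e\<bar> = 1 \<longleftrightarrow> \<bar>ps $ e\<bar> = 1) \<and> (\<bar>ps $ e\<bar> = 1 \<longrightarrow> p k $ e = ps $ e)"
    proof (cases "g ps $ e = 0")
      case True
      show ?thesis using inactive[OF True] by eventually_elim (use strict[OF True] in auto)
    next
      case False
      have "\<forall>\<^sub>F k in sequentially. p k $ e = ps $ e" using active[OF False] by blast
      then show ?thesis by eventually_elim auto
    qed
  qed
  then show "\<forall>\<^sub>F k in sequentially. active_set (p k) = active_set ps \<and> (\<forall>e\<in>active_set ps. p k $ e = ps $ e)"
    by eventually_elim (auto simp: active_set_def)
qed

section \<open>Face coordinates\<close>

lemma inactive_space_iff: "x \<in> inactive_space T A \<longleftrightarrow> (\<forall>e\<in>A. (matrix_inv_sqrt T *v x) $ e = 0)"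
proof -
  have "(coord_proj A *v y) $ e = (if e \<in> A then y $ e else 0)" for y e
    by (simp add: coord_proj_def diag_matrix_def matrix_vector_mult_def if_distrib[where f="\<lambda>x. x * _"]
        cong: if_cong)
  then show ?thesis
    by (auto simp: inactive_space_def matrix_vector_mul_assoc[symmetric] vec_eq_iff)
qed

lemma subspace_inactive_space: "subspace (inactive_space T A)"
  by (auto simp: subspace_def inactive_space_iff matrix_vector_right_distrib matrix_vector_mult_scaleR)

lemma projected_operator_in_inactive_space: "projected_operator T A K *v v \<in> inactive_space T A"
  using orth_proj(1)[OF subspace_inactive_space]
  by (simp add: projected_operator_def matrix_vector_mul_assoc[symmetric])

lemma inner_projected_operator:
  assumes "pos_def T" "u \<in> inactive_space T A"
  shows "(projected_operator T A K *v v) \<bullet> u = (K *v v) \<bullet> (matrix_inv_sqrt T *v u)"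
  using orth_proj(2)[OF subspace_inactive_space assms(2)] matrix_inv_sqrt_symmetric[OF assms(1)]
  by (simp add: projected_operator_def matrix_vector_mul_assoc[symmetric])

lemma transpose_projected_operator:
  assumes "pos_def T" "u \<in> inactive_space T A"
  shows "transpose (projected_operator T A K) *v u = transpose K *v (matrix_inv_sqrt T *v u)"
proof -
  have "(transpose (projected_operator T A K) *v u - transpose K *v (matrix_inv_sqrt T *v u)) \<bullet> v = 0" for v
    unfolding inner_diff_left inner_transpose_matrix_vector
    using inner_projected_operator[OF assms, of K v] by (simp add: inner_commute)
  then show ?thesis using inner_eq_zero_iff right_minus_eq by blast
qed

text \<open>
  Both sides lie in the inactive space, so it suffices to test against its elements \<open>u\<close>. The products
  become \<open>t (T d) \<bullet> T\<^sup>-\<^sup>1\<^sup>/\<^sup>2 u\<close> and \<open>K v \<bullet> T\<^sup>-\<^sup>1\<^sup>/\<^sup>2 u\<close>, which see only the coordinates outside \<open>A\<close>.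
\<close>

lemma rescaled_step_eq_projected_operator:
  assumes T: "pos_def T" and d: "\<And>e. e \<in> A \<Longrightarrow> d $ e = 0"
    and step: "\<And>e. e \<notin> A \<Longrightarrow> (t *\<^sub>R (T *v d)) $ e = (K *v v) $ e"
  shows "t *\<^sub>R (matrix_sqrt T *v d) = projected_operator T A K *v v"
proof -
  let ?S = "matrix_sqrt T" and ?Si = "matrix_inv_sqrt T"
  let ?w = "t *\<^sub>R (?S *v d) - projected_operator T A K *v v"
  have "?S *v d \<in> inactive_space T A"
    using d by (simp add: inactive_space_iff matrix_inv_sqrt_cancel[OF T])
  then have w: "?w \<in> inactive_space T A"
    by (intro subspace_diff subspace_scale subspace_inactive_space projected_operator_in_inactive_space)
  have "(?S *v d) \<bullet> ?w = (?S *v d) \<bullet> (?S *v (?Si *v ?w))"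
    by (simp only: matrix_inv_sqrt_cancel[OF T])
  also have "\<dots> = (T *v d) \<bullet> (?Si *v ?w)"
    using matrix_sqrt[OF T]
    by (metis matrix_vector_mul_assoc pos_def_def symmetric_matrix_inner)
  finally have "?w \<bullet> ?w = (t *\<^sub>R (T *v d) - K *v v) \<bullet> (?Si *v ?w)"
    unfolding inner_diff_left[of "t *\<^sub>R (?S *v d)"] inner_projected_operator[OF T w]
    by (simp add: inner_diff_left)
  also have "\<dots> = (\<Sum>e\<in>UNIV. (t *\<^sub>R (T *v d) - K *v v) $ e * (?Si *v ?w) $ e)"
    by (simp add: inner_vec_def)
  also have "\<dots> = 0"
  proof (rule sum.neutral, rule ballI)
    fix e
    show "(t *\<^sub>R (T *v d) - K *v v) $ e * (?Si *v ?w) $ e = 0"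
      using step[of e] w[unfolded inactive_space_iff] by (cases "e \<in> A") auto
  qed
  finally show ?thesis by simp
qed

section \<open>Linear convergence on the range\<close>

text \<open>
  The component orthogonal to \<open>R\<close> is constant and tends to zero. This places the error in the range of
  the projected operator, where the smallest \<^emph>\<open>positive\<close> singular value controls it.
\<close>

lemma null_sequence_in_subspace_of_increments:
  fixes z :: "nat \<Rightarrow> 'a::euclidean_space"
  assumes R: "subspace R" and inc: "\<And>k. k \<ge> k0 \<Longrightarrow> z (Suc k) - z k \<in> R"
    and lim: "z \<longlonglongrightarrow> 0" and k: "k \<ge> k0"
  shows "z k \<in> R"
proof -
  have mem: "z k - z (k + n) \<in> R" for n
  proof (induction n)
    case (Suc n)
    have "z (Suc (k + n)) - z (k + n) \<in> R" using k by (intro inc) simp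
    from subspace_diff[OF R Suc this] show ?case by simp
  qed (use subspace_0[OF R] in simp)
  have diff_lim: "(\<lambda>n. z k - z (k + n)) \<longlonglongrightarrow> z k - 0"
    using LIMSEQ_ignore_initial_segment[OF lim, of k]
    by (intro tendsto_diff tendsto_const) (simp add: add.commute)
  have "z k - 0 \<in> R"
    by (rule closed_sequentially[OF closed_subspace[OF R] mem diff_lim])
  then show ?thesis by simp
qed

text \<open>
  Along the segment from \<open>0\<close> to \<open>z\<close> the step map has derivative \<open>f y z\<close> with \<open>f y = I - B (H y) B\<^sup>T / t\<close>.
  On the range of \<open>B\<close> the quadratic form of \<open>B (H y) B\<^sup>T\<close> lies between \<open>a \<parallel>x\<parallel>\<^sup>2\<close> and \<open>b \<parallel>x\<parallel>\<^sup>2\<close>, and \<open>t\<close> is the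
  midpoint of \<open>a\<close> and \<open>b\<close>, so the form of \<open>f y\<close> is bounded by \<open>(b - a) / (b + a)\<close> in absolute value. The
  rate is nonnegative since some nonzero vector satisfies these bounds.
\<close>

lemma gradient_step_contraction:
  fixes B :: "real ^ 'v ^ 'e" and h :: "real ^ 'v \<Rightarrow> real ^ 'v" and l L t :: real
  assumes B: "B \<noteq> 0" and lL: "0 < l" "0 < L"
    and deriv: "\<And>y. (h has_derivative ((*v) (H y))) (at y)"
    and sym: "\<And>y. transpose (H y) = H y"
    and lower: "\<And>y v. l * (norm v)\<^sup>2 \<le> v \<bullet> (H y *v v)"
    and upper: "\<And>y v. v \<bullet> (H y *v v) \<le> L * (norm v)\<^sup>2"
    and step: "classical_step l L B t"
    and \<phi>: "\<phi> = (cond_number B)\<^sup>2 * (L / l)"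
  shows "0 \<le> (\<phi> - 1) / (\<phi> + 1)"
    and "z \<in> range ((*v) B) \<Longrightarrow>
      norm (z + (1 / t) *\<^sub>R (B *v (h (c - transpose B *v z) - h c))) \<le> (\<phi> - 1) / (\<phi> + 1) * norm z"
      (is "_ \<Longrightarrow> ?contraction")
proof -
  let ?R = "range ((*v) B)"
  define a where "a = l * (sigma_min_pos B)\<^sup>2"
  define b where "b = L * (sigma_max B)\<^sup>2"
  note sv = singular_value_bounds_on_range[OF B]
  have a: "a > 0" using sv(1) lL by (simp add: a_def)
  have b: "b \<ge> 0" using lL by (simp add: b_def)
  have t: "t = (a + b) / 2" using step B by (simp add: classical_step_def a_def b_def)
  have ba: "\<phi> = b / a" by (simp add: \<phi> cond_number_def a_def b_def power_divide mult.commute)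
  have rate: "(\<phi> - 1) / (\<phi> + 1) = (b - a) / (b + a)"
    unfolding ba using a b by (simp add: divide_simps)
  define f where "f y x = x - (1 / t) *\<^sub>R (B *v (H y *v (transpose B *v x)))" for y x
  have lin: "linear (f y)" for y
    by (rule linearI) (simp_all add: f_def matrix_vector_right_distrib matrix_vector_mult_scaleR
        algebra_simps del: transpose_matrix_vector)
  have form: "x \<bullet> f y x' = x \<bullet> x' - (transpose B *v x) \<bullet> (H y *v (transpose B *v x')) / t" for x x' y
    unfolding f_def inner_diff_right inner_scaleR_right inner_transpose_matrix_vector by simp
  have fsym: "f y x \<bullet> x' = x \<bullet> f y x'" for y x x'
    using form[of x' y x] form[of x y x'] symmetric_matrix_inner[OF sym, of y]
    by (simp add: inner_commute del: transpose_matrix_vector)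
  have R: "subspace ?R" by (intro linear_subspace_image) auto
  have inv: "f y ` ?R \<subseteq> ?R" for y
    unfolding f_def using R by (auto intro!: subspace_diff subspace_scale simp del: transpose_matrix_vector)
  have bound: "\<bar>x \<bullet> f y x\<bar> \<le> (\<phi> - 1) / (\<phi> + 1) * (norm x)\<^sup>2" if x: "x \<in> ?R" for x y
  proof -
    define w where "w = transpose B *v x"
    define q where "q = w \<bullet> (H y *v w)"
    have "a * (norm x)\<^sup>2 \<le> l * (norm w)\<^sup>2"
      using mult_left_mono[OF sv(2)[OF x], of l] lL by (simp add: a_def w_def mult.assoc del: transpose_matrix_vector)
    with lower[of w y] have lo: "a * (norm x)\<^sup>2 \<le> q" by (simp add: q_def)
    have "L * (norm w)\<^sup>2 \<le> b * (norm x)\<^sup>2"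
      using mult_left_mono[OF sv(3)[OF x], of L] lL by (simp add: b_def w_def mult.assoc del: transpose_matrix_vector)
    with upper[of w y] have hi: "q \<le> b * (norm x)\<^sup>2" by (simp add: q_def)
    have "x \<bullet> f y x = (norm x)\<^sup>2 - q / t"
      unfolding form q_def w_def power2_norm_eq_inner ..
    also have "\<dots> = ((a + b) * (norm x)\<^sup>2 - 2 * q) / (b + a)"
      unfolding t using a b by (simp add: field_simps)
    finally have eq: "x \<bullet> f y x = \<dots>" .
    have "\<bar>(a + b) * (norm x)\<^sup>2 - 2 * q\<bar> \<le> (b - a) * (norm x)\<^sup>2"
      using lo hi by (simp add: abs_le_iff algebra_simps)
    then have "\<bar>(a + b) * (norm x)\<^sup>2 - 2 * q\<bar> / (b + a) \<le> (b - a) * (norm x)\<^sup>2 / (b + a)"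
      using a b by (intro divide_right_mono) auto
    then show ?thesis unfolding eq rate using a b by (simp add: abs_divide)
  qed
  obtain x where x: "x \<in> ?R" "x \<noteq> 0" using nonzero_matrix_range[OF B] by blast
  have "0 \<le> (\<phi> - 1) / (\<phi> + 1) * (norm x)\<^sup>2"
    using bound[OF x(1), of 0] by linarith
  then show "0 \<le> (\<phi> - 1) / (\<phi> + 1)"
    using x(2) by (metis mult_neg_pos not_less zero_less_norm_iff zero_less_power)
  show ?contraction if z: "z \<in> ?R"
  proof -
    define u where "u = transpose B *v z"
    define F where "F s = s *\<^sub>R z + (1 / t) *\<^sub>R (B *v h (c - s *\<^sub>R u))" for s :: real
    have F': "(F has_derivative (\<lambda>\<epsilon>. \<epsilon> *\<^sub>R f (c - s *\<^sub>R u) z)) (at s within X)" for s X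
    proof -
      have "((\<lambda>s. c - s *\<^sub>R u) has_derivative (\<lambda>\<epsilon>. - (\<epsilon> *\<^sub>R u))) (at s within X)"
        by (auto intro!: derivative_eq_intros)
      from has_derivative_compose[OF this deriv]
      have h: "((\<lambda>s. h (c - s *\<^sub>R u)) has_derivative (\<lambda>\<epsilon>. H (c - s *\<^sub>R u) *v - (\<epsilon> *\<^sub>R u))) (at s within X)" .
      have bl: "bounded_linear ((*v) B)" by (simp add: linear_linear[symmetric])
      have "(F has_derivative (\<lambda>\<epsilon>. \<epsilon> *\<^sub>R z + (1 / t) *\<^sub>R (B *v (H (c - s *\<^sub>R u) *v - (\<epsilon> *\<^sub>R u))))) (at s within X)"
        unfolding F_def
        by (intro has_derivative_add has_derivative_scaleR_right has_derivative_scaleR_left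
            has_derivative_ident bounded_linear.has_derivative[OF bl h])
      moreover have "\<epsilon> *\<^sub>R z + (1 / t) *\<^sub>R (B *v (H (c - s *\<^sub>R u) *v - (\<epsilon> *\<^sub>R u))) = \<epsilon> *\<^sub>R f (c - s *\<^sub>R u) z" for \<epsilon>
        unfolding f_def u_def[symmetric]
        by (simp add: matrix_vector_mult_scaleR scaleR_diff_right flip: scaleR_minus_left)
      ultimately show ?thesis by simp
    qed
    \<comment> \<open>The mean value inequality for vector-valued functions needs only the derivative at one
      intermediate point, hence no average of Hessians.\<close>
    have "continuous_on {0..1} F"
      by (rule has_derivative_continuous_on) (rule F')
    then obtain s where "norm (F 1 - F 0) \<le> norm ((1 - 0) *\<^sub>R f (c - s *\<^sub>R u) z)"
      using mvt_general[of 0 1 F "\<lambda>s \<epsilon>. \<epsilon> *\<^sub>R f (c - s *\<^sub>R u) z"] F' by auto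
    also have "\<dots> \<le> (\<phi> - 1) / (\<phi> + 1) * norm z"
      using norm_le_of_quadratic_form[OF lin fsym R inv bound z] by simp
    also have "F 1 - F 0 = z + (1 / t) *\<^sub>R (B *v (h (c - u) - h c))"
      by (simp add: F_def matrix_vector_mult_diff_distrib scaleR_diff_right)
    finally show ?thesis unfolding u_def .
  qed
qed

lemma has_derivative_grad:
  assumes "twice_cont_diff f"
  shows "(grad f has_derivative ((*v) (hessian f y))) (at y)"
proof -
  have d: "(grad f has_derivative frechet_derivative (grad f) (at y)) (at y)"
    using assms frechet_derivative_works by (auto simp: twice_cont_diff_def)
  have "(*v) (hessian f y) = frechet_derivative (grad f) (at y)"
    unfolding hessian_def by (rule matrix_vector_mul(2)[OF has_derivative_linear[OF d]])
  then show ?thesis using d by simp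
qed

theorem theorem2:
  fixes src tgt :: "'e::finite \<Rightarrow> 'v::finite"
    and \<omega> :: "'e \<Rightarrow> real"
    and K :: "real ^ 'v ^ 'e"
    and G :: "real ^ 'v \<Rightarrow> ereal"
    and Gs :: "real ^ 'v \<Rightarrow> real"
    and l L t tlo thi :: real
    and T :: "nat \<Rightarrow> real ^ 'e ^ 'e"
    and p :: "nat \<Rightarrow> real ^ 'e"
    and pstar :: "real ^ 'e"
  assumes graph: "oriented_simple_graph src tgt"
    and weights: "\<And>e. 0 < \<omega> e"
    and K_def: "K = diag_matrix \<omega> ** graph_gradient src tgt"
    and G: "proper_fun G" "lower_semicont G" "convex_fun G"
    and conj: "\<And>y. fenchel_conj G y = ereal (Gs y)"
    and C2: "twice_cont_diff Gs"
    and lL: "0 < l" "0 < L"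
    and curvature: "\<And>y. mat l \<preceq>\<^sub>L hessian Gs y" "\<And>y. hessian Gs y \<preceq>\<^sub>L mat L"
    and spd: "\<And>k. pos_def (T k)"
    and t: "0 < t"
    and iteration: "\<And>k. is_arg_min
          (\<lambda>q. - ((K *v grad Gs (- (transpose K *v p k))) \<bullet> q) + t / 2 * (norm_wrt (T k) (q - p k))\<^sup>2)
          (\<lambda>q. infnorm q \<le> 1) (p (Suc k))"
    and converges: "p \<longlonglongrightarrow> pstar"
    and minimizer: "is_arg_min (\<lambda>q. Gs (- (transpose K *v q))) (\<lambda>q. infnorm q \<le> 1) pstar"
    and A1: "\<And>e. (K *v grad Gs (- (transpose K *v pstar))) $ e = 0 \<Longrightarrow> \<bar>pstar $ e\<bar> < 1"
    and A2: "0 < tlo" "0 < thi" "\<And>k. mat tlo \<preceq>\<^sub>L T k" "\<And>k. T k \<preceq>\<^sub>L mat thi"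
    and A3: "\<exists>\<tau>. \<forall>k. T k = \<tau> (active_set (p k))"
  shows "\<exists>kbar Tc.
      (\<forall>k\<ge>kbar. active_set (p k) = active_set pstar \<and> T k = Tc) \<and>
      (let B = projected_operator Tc (active_set pstar) K;
           \<phi> = (cond_number B)\<^sup>2 * (L / l)
       in classical_step l L B t \<longrightarrow>
          (\<forall>k\<ge>kbar. norm_wrt Tc (p k - pstar)
             \<le> ((\<phi> - 1) / (\<phi> + 1)) ^ (k - kbar) * norm_wrt Tc (p kbar - pstar)))"
proof -
  let ?A = "active_set pstar"
  define h where "h = grad Gs"
  define c where "c = - (transpose K *v pstar)"
  define g where "g q = K *v h (- (transpose K *v q))" for q
  have deriv: "(h has_derivative ((*v) (hessian Gs y))) (at y)" for y
    unfolding h_def by (rule has_derivative_grad[OF C2])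
  have contK: "isCont (\<lambda>q. - (transpose K *v q)) pstar" "isCont ((*v) K) y" for y
    by (intro continuous_minus linear_continuous_at matrix_vector_mul_bounded_linear)+
  have conth: "isCont h y" for y by (rule has_derivative_continuous[OF deriv])
  have cont: "isCont g pstar"
    unfolding g_def by (rule isCont_o2[OF isCont_o2[OF contK(1) conth] contK(2)])
  have iter: "is_arg_min (\<lambda>q. - (g (p k) \<bullet> q) + t / 2 * (norm_wrt (T k) (q - p k))\<^sup>2)
      (\<lambda>q. infnorm q \<le> 1) (p (Suc k))" for k
    unfolding g_def h_def by (rule iteration)
  have strict: "\<bar>pstar $ e\<bar> < 1" if "g pstar $ e = 0" for e
    using that unfolding g_def h_def by (rule A1)
  have ident: "\<forall>\<^sub>F k in sequentially. active_set (p k) = ?A \<and> (\<forall>e\<in>?A. p k $ e = pstar $ e)"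
    by (rule finite_identification(1)[OF spd A2(4) iter converges cont strict])
  have crit: "g pstar $ e = 0" if "e \<notin> ?A" for e
    by (rule finite_identification(2)[OF spd A2(4) iter converges cont strict that])
  from ident obtain kbar where kbar: "\<And>k. k \<ge> kbar \<Longrightarrow> active_set (p k) = ?A"
    "\<And>k e. k \<ge> kbar \<Longrightarrow> e \<in> ?A \<Longrightarrow> p k $ e = pstar $ e"
    unfolding eventually_sequentially by blast
  from A3 obtain \<tau> where "\<And>k. T k = \<tau> (active_set (p k))" by blast
  then have Tconst: "T k = T kbar" if "k \<ge> kbar" for k using kbar(1) that by simp
  define Tc where "Tc = T kbar"
  define B where "B = projected_operator Tc ?A K"
  define \<phi> where "\<phi> = (cond_number B)\<^sup>2 * (L / l)"
  let ?S = "matrix_sqrt Tc" and ?Si = "matrix_inv_sqrt Tc"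
  have Tc: "pos_def Tc" unfolding Tc_def by (rule spd)
  define z where "z k = ?S *v (p k - pstar)" for k
  have norm_z: "norm_wrt Tc (p k - pstar) = norm (z k)" for k
    unfolding z_def by (rule norm_wrt_eq_norm_matrix_sqrt[OF Tc])
  have Siz: "?Si *v z k = p k - pstar" for k
    unfolding z_def by (rule matrix_inv_sqrt_cancel(1)[OF Tc])
  have zU: "z k \<in> inactive_space Tc ?A" if "k \<ge> kbar" for k
    using kbar(2)[OF that] by (simp add: inactive_space_iff Siz)
  have arg: "- (transpose K *v p k) = c - transpose B *v z k" if "k \<ge> kbar" for k
    unfolding B_def transpose_projected_operator[OF Tc zU[OF that]] Siz c_def
    by (simp add: matrix_vector_mult_diff_distrib del: transpose_matrix_vector)
  have step: "t *\<^sub>R (z (Suc k) - z k) = B *v (h (c - transpose B *v z k) - h c)" if k: "k \<ge> kbar" for k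
  proof -
    let ?d = "p (Suc k) - p k" and ?v = "h (c - transpose B *v z k) - h c"
    have "t *\<^sub>R (?S *v ?d) = projected_operator Tc ?A K *v ?v"
    proof (rule rescaled_step_eq_projected_operator[OF Tc])
      show "?d $ e = 0" if "e \<in> ?A" for e using kbar(2)[of k e] kbar(2)[of "Suc k" e] k that by simp
      fix e assume e: "e \<notin> ?A"
      \<comment> \<open>A nonzero residual would put the coordinate on the boundary at step \<open>Suc k\<close>.\<close>
      have "(g (p k) - t *\<^sub>R (T k *v ?d)) $ e = 0"
      proof (rule ccontr)
        assume "(g (p k) - t *\<^sub>R (T k *v ?d)) $ e \<noteq> 0"
        then have "\<bar>p (Suc k) $ e\<bar> = 1"
          using box_prox_optimality[OF spd[of k] iter[of k], of e]
          by (cases "(g (p k) - t *\<^sub>R (T k *v ?d)) $ e > 0") auto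
        then show False using kbar(1)[of "Suc k"] k e by (auto simp: active_set_def)
      qed
      then have "(t *\<^sub>R (Tc *v ?d)) $ e = (g (p k) - g pstar) $ e"
        using Tconst[OF k] crit[OF e] by (simp add: Tc_def)
      also have "g (p k) - g pstar = K *v ?v"
        unfolding g_def arg[OF k] c_def[symmetric] matrix_vector_mult_diff_distrib ..
      finally show "(t *\<^sub>R (Tc *v ?d)) $ e = (K *v ?v) $ e" .
    qed
    moreover have "z (Suc k) - z k = ?S *v ?d"
      by (simp add: z_def matrix_vector_mult_diff_distrib)
    ultimately show ?thesis by (simp add: B_def)
  qed
  let ?R = "range ((*v) B)"
  have recurrence: "z (Suc k) = z k + (1 / t) *\<^sub>R (B *v (h (c - transpose B *v z k) - h c))" if "k \<ge> kbar" for k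
    unfolding step[OF that, symmetric] using t by simp
  have zR: "z k \<in> ?R" if "k \<ge> kbar" for k
  proof (rule null_sequence_in_subspace_of_increments[of ?R kbar])
    show "subspace ?R" by (intro linear_subspace_image) auto
    then show "z (Suc k) - z k \<in> ?R" if "k \<ge> kbar" for k
      unfolding recurrence[OF that] by (simp add: subspace_scale del: transpose_matrix_vector)
    have "(\<lambda>k. ?S *v (p k - pstar)) \<longlonglongrightarrow> ?S *v (pstar - pstar)"
      by (rule isCont_tendsto_compose[OF linear_continuous_at[OF matrix_vector_mul_bounded_linear]
            tendsto_diff[OF converges tendsto_const]])
    then show "z \<longlonglongrightarrow> 0" by (simp add: z_def[abs_def])
  qed (fact that)
  have conv: "norm (z k) \<le> ((\<phi> - 1) / (\<phi> + 1)) ^ (k - kbar) * norm (z kbar)"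
    if classical: "classical_step l L B t" and k: "k \<ge> kbar" for k
  proof (cases "B = 0")
    case True
    \<comment> \<open>Here \<open>\<phi> = 0\<close> and the rate is \<open>-1\<close>, but both norms vanish.\<close>
    then show ?thesis using zR[OF k] zR[OF order.refl] by auto
  next
    case False
    \<comment> \<open>The Loewner order includes symmetry of the difference, and so of the Hessian.\<close>
    have sym: "transpose (hessian Gs y) = hessian Gs y" for y
    proof -
      have diff: "transpose (mat L - hessian Gs y) = mat L - hessian Gs y"
        using curvature(2) by (simp add: loewner_le_def pos_semidef_def)
      have "hessian Gs y $ j $ i = hessian Gs y $ i $ j" for i j
        using arg_cong[OF diff, of "\<lambda>M. M $ i $ j"]
        by (simp add: transpose_def mat_def eq_commute[of j] split: if_splits)
      then show ?thesis by (simp add: transpose_def vec_eq_iff)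
    qed
    have lower: "l * (norm v)\<^sup>2 \<le> v \<bullet> (hessian Gs y *v v)" for y v
      using loewner_le_quadratic_form[OF curvature(1)] by (metis inner_scaleR_right mat_matrix_vector power2_norm_eq_inner)
    have upper: "v \<bullet> (hessian Gs y *v v) \<le> L * (norm v)\<^sup>2" for y v
      using loewner_le_quadratic_form[OF curvature(2)] by (metis inner_scaleR_right mat_matrix_vector power2_norm_eq_inner)
    note contraction = gradient_step_contraction[OF False lL deriv sym lower upper classical \<phi>_def]
    show ?thesis using k
    proof (induction k rule: dec_induct)
      case (step n)
      have "norm (z (Suc n)) \<le> (\<phi> - 1) / (\<phi> + 1) * norm (z n)"
        unfolding recurrence[OF step.hyps(1)] by (rule contraction(2)[OF zR[OF step.hyps(1)]])
      also have "\<dots> \<le> (\<phi> - 1) / (\<phi> + 1) * (((\<phi> - 1) / (\<phi> + 1)) ^ (n - kbar) * norm (z kbar))"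
        by (rule mult_left_mono[OF step.IH contraction(1)])
      finally show ?case using step.hyps(1) by (simp add: Suc_diff_le)
    qed simp
  qed
  show ?thesis
  proof (intro exI conjI)
    show "\<forall>k\<ge>kbar. active_set (p k) = ?A \<and> T k = Tc"
      unfolding Tc_def using kbar(1) Tconst by blast
    show "let B = projected_operator Tc ?A K; \<phi> = (cond_number B)\<^sup>2 * (L / l)
       in classical_step l L B t \<longrightarrow>
          (\<forall>k\<ge>kbar. norm_wrt Tc (p k - pstar)
             \<le> ((\<phi> - 1) / (\<phi> + 1)) ^ (k - kbar) * norm_wrt Tc (p kbar - pstar))"
      unfolding Let_def norm_z B_def[symmetric] \<phi>_def[symmetric] by (intro allI impI) (rule conv)
  qed
qed

end
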